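(* Let $P\subset\mathbb{R}^d$ be a polyhedral set with non-empty interior. Fix integers $0\le j<k\le d$. Let $A:\mathbb{R}^d\to\mathbb{R}^k$ be a linear map of full rank $k$ such that $\ker A$ is in general position with respect to $P$. If $F$ is a $j$-dimensional face of $P$, then the following statements are equivalent: (a) $AF$ is a face of $AP$; (b) $AF$ is a $j$-dimensional face of $AP$; (c) $AF\cap\mathrm{int}(AP)=\varnothing$; (d) $A(T_F(P))\neq\mathbb{R}^k$; (e) $(\mathrm{int}\,T_F(P))\cap\ker A=\varnothing$; (f) $T_F(P)\cap\ker A=\{0\}$.
   Context: A polyhedral set is an intersection of finitely many closed half-spaces (whose boundaries need not pass through the origin). Faces of $P$ include $P$ itself. The tangent cone of $P$ at a face $F$ is $T_F(P)=\{v\in\mathbb{R}^d: f_0+\varepsilon v\in P\text{ for some }\varepsilon>0\}$, where $f_0$ is any point of the relative interior of $F$. $\mathrm{int}$ denotes the interior. General position: for a convex set $M\subset\mathbb{R}^d$ let $L$ be the linear subspace with $\mathrm{aff}\,M=t+L$ for some $t\in\mathbb{R}^d$. $M$ is in general position with respect to a linear subspace $L'\subset\mathbb{R}^d$ if $\dim(L\cap L')=\max(\dim L-\mathrm{codim}\,L',0)$. A linear subspace $L'$ is in general position with respect to a polyhedral set $P$ if it is in general position with respect to all faces of $P$ of all dimensions. *)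

theory Defs
  imports "HOL-Analysis.Analysis"
begin

text \<open>
  The faces of a polyhedral set are the nonempty sets that are \<open>face_of\<close> it (the library relation
  \<open>face_of\<close> also admits the empty set).
\<close>

definition tangent_cone :: "'a::euclidean_space set \<Rightarrow> 'a set \<Rightarrow> 'a set" where
  "tangent_cone F P = {v. \<exists>f0 \<in> rel_interior F. \<exists>\<epsilon>>0. f0 + \<epsilon> *\<^sub>R v \<in> P}"

text \<open>The choice of the point in the relative interior of the face is irrelevant:\<close>

lemma tangent_cone_eq:
  fixes P :: "'a::euclidean_space set"
  assumes "convex P" "F face_of P" "f0 \<in> rel_interior F"
  shows "tangent_cone F P = {v. \<exists>\<epsilon>>0. f0 + \<epsilon> *\<^sub>R v \<in> P}"
proof (intro subset_antisym subsetI)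
  fix v assume "v \<in> {v. \<exists>\<epsilon>>0. f0 + \<epsilon> *\<^sub>R v \<in> P}"
  then show "v \<in> tangent_cone F P"
    using assms(3) by (auto simp: tangent_cone_def)
next
  fix v assume "v \<in> tangent_cone F P"
  then obtain f1 \<epsilon> where f1: "f1 \<in> rel_interior F" and e: "\<epsilon> > 0" and P1: "f1 + \<epsilon> *\<^sub>R v \<in> P"
    by (auto simp: tangent_cone_def)
  have cF: "convex F"
    using face_of_imp_convex[OF assms(2)] .
  have "f1 \<in> affine hull F"
    using f1 rel_interior_subset[of F] hull_subset[of F affine] by blast
  then obtain m where m: "m > 1"
    and me: "\<forall>e. e > 1 \<and> e \<le> m \<longrightarrow> (1 - e) *\<^sub>R f1 + e *\<^sub>R f0 \<in> F"
    using bspec[OF convex_rel_interior_if[OF cF assms(3)]] by blast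
  have g: "(1 - m) *\<^sub>R f1 + m *\<^sub>R f0 \<in> F"
    using me m by blast
  let ?g = "(1 - m) *\<^sub>R f1 + m *\<^sub>R f0"
  have gP: "?g \<in> P"
    using g face_of_imp_subset[OF assms(2)] by blast
  have "((m - 1) / m) *\<^sub>R (f1 + \<epsilon> *\<^sub>R v) + (1 / m) *\<^sub>R ?g \<in> P"
  proof (rule convexD[OF assms(1) P1 gP])
    show "0 \<le> (m - 1) / m" "0 \<le> 1 / m"
      using m by simp_all
    show "(m - 1) / m + 1 / m = 1"
      using m by (simp add: diff_divide_distrib)
  qed
  moreover have "((m - 1) / m) *\<^sub>R (f1 + \<epsilon> *\<^sub>R v) + (1 / m) *\<^sub>R ?g
      = f0 + ((m - 1) / m * \<epsilon>) *\<^sub>R v"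
  proof -
    have *: "a *\<^sub>R (f1 + \<epsilon> *\<^sub>R v) + b *\<^sub>R (c *\<^sub>R f1 + m *\<^sub>R f0)
        = (a + b * c) *\<^sub>R f1 + (b * m) *\<^sub>R f0 + (a * \<epsilon>) *\<^sub>R v" for a b c
      by (simp only: scaleR_add_right scaleR_add_left scaleR_scaleR ac_simps)
    have "(m - 1) / m + 1 / m * (1 - m) = 0" "1 / m * m = 1"
      using m by (simp_all add: divide_simps)
    then show ?thesis
      by (simp only: * scaleR_zero_left scaleR_one add_0_left)
  qed
  ultimately have "f0 + ((m - 1) / m * \<epsilon>) *\<^sub>R v \<in> P"
    by (simp only:)
  moreover have "(m - 1) / m * \<epsilon> > 0"
    using m e by simp
  ultimately show "v \<in> {v. \<exists>\<epsilon>>0. f0 + \<epsilon> *\<^sub>R v \<in> P}"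
    by blast
qed

text \<open>
  The subspace \<open>L\<close> below is uniquely determined by the nonempty set \<open>M\<close>; the dimension formula is
  stated in the integers because \<open>dim L - codim L'\<close> may be negative.
\<close>

definition convex_general_position :: "'a::euclidean_space set \<Rightarrow> 'a set \<Rightarrow> bool" where
  "convex_general_position M L' \<longleftrightarrow>
     (\<exists>L t. subspace L \<and> affine hull M = (+) t ` L \<and>
        int (dim (L \<inter> L')) = max (int (dim L) - (int DIM('a) - int (dim L'))) 0)"

definition general_position :: "'a::euclidean_space set \<Rightarrow> 'a set \<Rightarrow> bool" where
  "general_position L' P \<longleftrightarrow>
     (\<forall>G. G face_of P \<and> G \<noteq> {} \<longrightarrow> convex_general_position G L')"

abbreviation lin_kernel :: "('a::real_vector \<Rightarrow> 'b::real_vector) \<Rightarrow> 'a set" where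
  "lin_kernel A \<equiv> {x. A x = 0}"

end

theory Submission
  imports Defs
begin

text \<open>
  Fix a point \<open>f0\<close> in the relative interior of \<open>F\<close> and write \<open>T\<close> for the tangent cone of \<open>P\<close> at \<open>F\<close> and
  \<open>K\<close> for the kernel of \<open>A\<close>. The conditions are linked in the cycle
  (a) \<open>\<Longrightarrow>\<close> (c) \<open>\<Longrightarrow>\<close> (d) \<open>\<Longrightarrow>\<close> (e) \<open>\<Longrightarrow>\<close> (f) \<open>\<Longrightarrow>\<close> (a), and (b) is added to (a) by a dimension count.

  A face of \<open>A P\<close> that meets the interior of \<open>A P\<close> is all of \<open>A P\<close>, which is impossible for \<open>A F\<close>
  because \<open>j < k\<close>; this is (a) \<open>\<Longrightarrow>\<close> (c). If \<open>A T\<close> is the whole space, one can leave \<open>f0\<close> in a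
  direction of \<open>T\<close> that in the image points exactly away from a given interior point \<open>c\<close> of \<open>P\<close>; mixing
  the point so reached with \<open>c\<close> gives an interior point of \<open>P\<close> over \<open>A f0\<close>
  (\<open>tangent_cone_image_UNIV_imp_interior\<close>), hence (c) \<open>\<Longrightarrow>\<close> (d). A cone with an interior point that is
  mapped to \<open>0\<close> has full image (\<open>image_cone_eq_UNIV\<close>), hence (d) \<open>\<Longrightarrow>\<close> (e).

  General position enters in (e) \<open>\<Longrightarrow>\<close> (f). A nonzero \<open>v \<in> T \<inter> K\<close> gives a segment in \<open>P\<close> parallel
  to \<open>K\<close>. The face \<open>G\<close> of \<open>P\<close> with the midpoint \<open>x\<close> of this segment in its relative interior contains
  the whole segment, so the direction space of \<open>G\<close> meets \<open>K\<close> nontrivially, and general position makes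
  the two subspaces span everything (\<open>general_position_sum_UNIV\<close>). The vector from \<open>x\<close> to an interior
  point of \<open>P\<close> is therefore a sum of a direction of \<open>G\<close> and a vector of \<open>K\<close>; the former can be
  compensated by moving slightly inside \<open>G\<close>, so moving from \<open>x\<close> along \<open>K\<close> already leads into the
  interior of \<open>P\<close> (\<open>general_position_fibre_meets_interior\<close>).

  For (f) \<open>\<Longrightarrow>\<close> (a), \<open>T \<inter> K = {0}\<close> says that over \<open>A F\<close> the set \<open>P\<close> has no points other than those of \<open>F\<close>
  (\<open>diff_mem_tangent_cone\<close>), so that the defining property of a face passes from \<open>F\<close> to \<open>A F\<close>.
  Finally, as \<open>j < k\<close>, general position with respect to \<open>F\<close> itself makes \<open>A\<close> injective on the direction
  space of \<open>F\<close>, so \<open>A F\<close> has dimension \<open>j\<close>.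
\<close>

section \<open>Faces and interior points of convex sets\<close>

text \<open>
  A face of least dimension among those containing \<open>x\<close> works: otherwise a supporting hyperplane at \<open>x\<close>
  would cut out a smaller one.
\<close>

lemma exists_face_rel_interior:
  fixes S :: "'a::euclidean_space set"
  assumes "convex S" "x \<in> S"
  obtains G where "G face_of S" "x \<in> rel_interior G"
proof -
  define C where "C = {G. G face_of S \<and> x \<in> G}"
  have "S \<in> C"
    using assms by (simp add: C_def face_of_refl)
  then obtain G where "G \<in> C"
    and least: "\<And>H. H \<in> C \<Longrightarrow> nat (aff_dim G) \<le> nat (aff_dim H)"
    using exists_least_iff[of "\<lambda>n. \<exists>G\<in>C. n = nat (aff_dim G)"] by (metis linorder_not_le)
  then have G: "G face_of S" "x \<in> G"
    by (auto simp: C_def)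
  have "convex G"
    using G face_of_imp_convex by blast
  have "x \<in> rel_interior G"
  proof (rule ccontr)
    assume "x \<notin> rel_interior G"
    then obtain a where a: "\<And>y. y \<in> G \<Longrightarrow> a \<bullet> x \<le> a \<bullet> y"
      "\<And>y. y \<in> rel_interior G \<Longrightarrow> a \<bullet> x < a \<bullet> y"
      using supporting_hyperplane_rel_boundary[OF \<open>convex G\<close> G(2)] by metis
    define H where "H = G \<inter> {y. a \<bullet> y = a \<bullet> x}"
    have H: "H face_of G"
      unfolding H_def using \<open>convex G\<close> a(1) by (rule face_of_Int_supporting_hyperplane_ge)
    have "x \<in> H"
      using G by (simp add: H_def)
    have "rel_interior G \<noteq> {}"
      using \<open>convex G\<close> G(2) by (auto simp: rel_interior_eq_empty)
    then have "H \<noteq> G"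
      using a(2) rel_interior_subset[of G] by (force simp: H_def)
    then have "aff_dim H < aff_dim G"
      using face_of_aff_dim_lt[OF \<open>convex G\<close> H] by blast
    moreover have "0 \<le> aff_dim H"
      using \<open>x \<in> H\<close> aff_dim_negative_iff[of H] by (metis empty_iff linorder_not_less)
    moreover have "H \<in> C"
      using \<open>x \<in> H\<close> face_of_trans[OF H G(1)] by (simp add: C_def)
    ultimately show False
      using least[of H] by linarith
  qed
  with G(1) that show thesis
    by blast
qed

lemma convex_interior_mix:
  fixes S :: "'a::euclidean_space set"
  assumes "convex S" "x \<in> S" "c \<in> interior S" "0 < (e::real)"
  shows "(1 / (1 + e)) *\<^sub>R x + (e / (1 + e)) *\<^sub>R c \<in> interior S"
proof -
  have *: "1 / (1 + e) = 1 - e / (1 + e)"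
    using assms(4) by (simp add: field_simps)
  have "x - (e / (1 + e)) *\<^sub>R (x - c) \<in> interior S"
    using assms by (intro mem_interior_convex_shrink) auto
  moreover have "x - (e / (1 + e)) *\<^sub>R (x - c) = (1 / (1 + e)) *\<^sub>R x + (e / (1 + e)) *\<^sub>R c"
    unfolding * by (simp add: algebra_simps)
  ultimately show ?thesis
    by simp
qed

section \<open>Tangent cones\<close>

lemma tangent_cone_scaleR:
  assumes "v \<in> tangent_cone F P" "0 < c"
  shows "c *\<^sub>R v \<in> tangent_cone F P"
proof -
  obtain f0 e where f: "f0 \<in> rel_interior F" "0 < e" "f0 + e *\<^sub>R v \<in> P"
    using assms(1) by (auto simp: tangent_cone_def)
  moreover have "f0 + (e / c) *\<^sub>R (c *\<^sub>R v) = f0 + e *\<^sub>R v" "0 < e / c"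
    using assms(2) f(2) by auto
  ultimately show ?thesis
    unfolding tangent_cone_def by (smt (verit) mem_Collect_eq)
qed

text \<open>
  The reference point \<open>f\<close> may lie anywhere in \<open>F\<close>: extending the segment from \<open>f\<close> to a relative
  interior point \<open>f0\<close> slightly beyond \<open>f0\<close> within \<open>F\<close> exhibits \<open>f0\<close> as a mixture of \<open>f\<close> and another point
  of \<open>F\<close>.
\<close>

lemma diff_mem_tangent_cone:
  fixes P :: "'a::euclidean_space set"
  assumes "convex P" "F face_of P" "f \<in> F" "p \<in> P"
  shows "p - f \<in> tangent_cone F P"
proof -
  have cF: "convex F"
    using assms(2) by (rule face_of_imp_convex)
  then obtain f0 where f0: "f0 \<in> rel_interior F"
    using assms(3) rel_interior_eq_empty[of F] by blast
  have "f \<in> affine hull F"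
    using assms(3) by (rule hull_inc)
  then obtain m where m: "m > 1" "(1 - m) *\<^sub>R f + m *\<^sub>R f0 \<in> F"
    using convex_rel_interior_if2[OF cF f0] by blast
  let ?g = "(1 - m) *\<^sub>R f + m *\<^sub>R f0"
  have "?g \<in> P"
    using m(2) face_of_imp_subset[OF assms(2)] by blast
  then have "((m - 1) / m) *\<^sub>R p + (1 / m) *\<^sub>R ?g \<in> P"
    using m(1) by (intro convexD[OF assms(1,4)]) (auto simp: diff_divide_distrib)
  moreover have "((m - 1) / m) *\<^sub>R p + (1 / m) *\<^sub>R ?g = f0 + ((m - 1) / m) *\<^sub>R (p - f)"
  proof -
    have "(1 / m) *\<^sub>R ?g = f0 - ((m - 1) / m) *\<^sub>R f"
      using m(1) by (simp add: scaleR_add_right diff_divide_distrib scaleR_left_diff_distrib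
          scaleR_right_diff_distrib)
    then show ?thesis
      by (simp add: algebra_simps)
  qed
  ultimately have "f0 + ((m - 1) / m) *\<^sub>R (p - f) \<in> P"
    by simp
  moreover have "0 < (m - 1) / m"
    using m(1) by simp
  ultimately show ?thesis
    using f0 unfolding tangent_cone_def by blast
qed

lemma interior_diff_mem_interior_tangent_cone:
  fixes P :: "'a::euclidean_space set"
  assumes "convex P" "F face_of P" "f \<in> F" "p \<in> interior P"
  shows "p - f \<in> interior (tangent_cone F P)"
proof (rule interiorI)
  show "open ((\<lambda>x. x - f) ` interior P)"
    using open_translation_subtract[of "interior P" f] by simp
  show "p - f \<in> (\<lambda>x. x - f) ` interior P"
    using assms(4) by blast
  show "(\<lambda>x. x - f) ` interior P \<subseteq> tangent_cone F P"
    using diff_mem_tangent_cone[OF assms(1-3)] interior_subset[of P] by blast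
qed

text \<open>
  If \<open>A v = A f0 - A c\<close>, then \<open>A\<close> maps \<open>f0 + e v\<close> and \<open>c\<close> to opposite sides of \<open>A f0\<close>, at distances in
  ratio \<open>e\<close> to \<open>1\<close>.
\<close>

lemma tangent_cone_image_UNIV_imp_interior:
  fixes P :: "'a::euclidean_space set" and A :: "'a \<Rightarrow> 'b::euclidean_space"
  assumes "convex P" "interior P \<noteq> {}" "linear A" "F face_of P" "f0 \<in> rel_interior F"
    and UNIV: "A ` tangent_cone F P = UNIV"
  shows "\<exists>w \<in> interior P. A w = A f0"
proof -
  interpret linear A by fact
  obtain c where c: "c \<in> interior P"
    using assms(2) by blast
  obtain v where v: "v \<in> tangent_cone F P" "A v = A f0 - A c"
    using UNIV by (metis UNIV_I imageE)
  obtain e where e: "0 < e" "f0 + e *\<^sub>R v \<in> P"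
    using v(1) tangent_cone_eq[OF assms(1,4,5)] by auto
  let ?w = "(1 / (1 + e)) *\<^sub>R (f0 + e *\<^sub>R v) + (e / (1 + e)) *\<^sub>R c"
  have "?w \<in> interior P"
    using convex_interior_mix[OF assms(1) e(2) c e(1)] .
  moreover have "A ?w = A f0"
  proof -
    have "A ?w = (1 / (1 + e)) *\<^sub>R (A f0 + e *\<^sub>R (A f0 - A c)) + (e / (1 + e)) *\<^sub>R A c"
      by (simp add: add scale v(2))
    also have "\<dots> = (1 / (1 + e)) *\<^sub>R ((1 + e) *\<^sub>R A f0)"
      by (simp add: algebra_simps)
    also have "\<dots> = A f0"
      using e(1) by simp
    finally show ?thesis .
  qed
  ultimately show ?thesis
    by blast
qed

text \<open>Over each \<open>y = A z\<close>, the point \<open>v + d z\<close> near \<open>v\<close> is mapped to \<open>d y\<close>; rescaling gives \<open>y\<close>.\<close>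

lemma image_cone_eq_UNIV:
  fixes A :: "'a::real_normed_vector \<Rightarrow> 'b::real_normed_vector"
  assumes "linear A" "surj A"
    and cone: "\<And>v c. v \<in> T \<Longrightarrow> 0 < c \<Longrightarrow> c *\<^sub>R v \<in> T"
    and v: "v \<in> interior T" "A v = 0"
  shows "A ` T = UNIV"
proof -
  interpret linear A by fact
  have "y \<in> A ` T" for y
  proof -
    obtain z where z: "y = A z"
      using assms(2) by (meson surjD)
    obtain r where r: "0 < r" "ball v r \<subseteq> T"
      using v(1) by (auto simp: mem_interior)
    define d where "d = r / (1 + norm z)"
    have d: "0 < d"
      using r(1) by (simp add: d_def add_pos_nonneg)
    have "d * norm z < r"
      using r(1) by (simp add: d_def divide_simps add_pos_nonneg)
    then have "v + d *\<^sub>R z \<in> T"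
      using r(2) d by (auto simp: dist_norm)
    then have "(1 / d) *\<^sub>R (v + d *\<^sub>R z) \<in> T"
      using cone d by simp
    moreover have "A ((1 / d) *\<^sub>R (v + d *\<^sub>R z)) = y"
      using d by (simp add: add scale v(2) z)
    ultimately show ?thesis
      by (metis imageI)
  qed
  then show ?thesis
    by blast
qed

section \<open>General position\<close>

text \<open>
  A nontrivial intersection of the direction space with \<open>K\<close> forces the maximum in the definition to be
  attained by its first argument, and then the dimension formula for sums applies.
\<close>

lemma general_position_sum_UNIV:
  fixes G K :: "'a::euclidean_space set"
  assumes "convex_general_position G K" "subspace K"
    and "a \<in> G" "b \<in> G" "a \<noteq> b" "b - a \<in> K"
  obtains L t where "subspace L" "affine hull G = (+) t ` L" "\<And>w. \<exists>l\<in>L. \<exists>u\<in>K. w = l + u"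
proof -
  obtain L t where L: "subspace L" "affine hull G = (+) t ` L"
    and d: "int (dim (L \<inter> K)) = max (int (dim L) - (int DIM('a) - int (dim K))) 0"
    using assms(1) unfolding convex_general_position_def by blast
  have "a \<in> (+) t ` L" "b \<in> (+) t ` L"
    using assms(3,4) L(2) hull_inc by metis+
  then have "b - a \<in> L"
    using subspace_diff[OF L(1)] by force
  then have "dim (L \<inter> K) \<noteq> 0"
    using assms(5,6) by (auto simp: dim_eq_0)
  then have "dim {x + y |x y. x \<in> L \<and> y \<in> K} = DIM('a)"
    using d dim_sums_Int[OF L(1) assms(2)] by linarith
  then have "{x + y |x y. x \<in> L \<and> y \<in> K} = UNIV"
    using subspace_sums[OF L(1) assms(2)] by (simp add: dim_eq_full span_eq_iff[THEN iffD2])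
  then have "\<exists>l\<in>L. \<exists>u\<in>K. w = l + u" for w
    by blast
  with L that show thesis
    by blast
qed

text \<open>
  With \<open>l\<close> a direction of the face \<open>G\<close> around \<open>x\<close> and \<open>x + l + u\<close> interior to \<open>P\<close>, the point \<open>x - s l\<close>
  still lies in \<open>G\<close> for small \<open>s > 0\<close>, and the mixture of the two points that cancels \<open>l\<close> is an
  interior point of \<open>P\<close> in \<open>x + K\<close>.
\<close>

lemma general_position_fibre_meets_interior:
  fixes P K :: "'a::euclidean_space set"
  assumes "convex P" "interior P \<noteq> {}" "subspace K" "general_position K P"
    and "p \<in> P" "q \<in> P" "p \<noteq> q" "q - p \<in> K"
  shows "\<exists>w \<in> interior P. w - p \<in> K"
proof -
  define x where "x = midpoint p q"
  have x: "x \<in> open_segment p q"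
    using assms(7) by (simp add: x_def)
  then have "x \<in> P"
    using closed_segment_subset[OF assms(5,6,1)] open_closed_segment by blast
  then obtain G where G: "G face_of P" "x \<in> rel_interior G"
    using exists_face_rel_interior[OF assms(1)] by blast
  have xG: "x \<in> G"
    using G(2) rel_interior_subset by blast
  have pq: "p \<in> G" "q \<in> G"
    using face_ofD[OF G(1) x assms(5,6) xG] by auto
  have "convex_general_position G K"
    using assms(4) G(1) xG unfolding general_position_def by blast
  then obtain L t where L: "subspace L" "affine hull G = (+) t ` L"
    and sum: "\<And>w. \<exists>l\<in>L. \<exists>u\<in>K. w = l + u"
    using general_position_sum_UNIV[OF _ assms(3) pq assms(7,8)] by blast
  obtain c where c: "c \<in> interior P"
    using assms(2) by blast
  obtain l u where l: "l \<in> L" and u: "u \<in> K" and lu: "c - x = l + u"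
    using sum by blast
  have "x \<in> (+) t ` L"
    using xG L(2) hull_inc by metis
  then have "x + l \<in> affine hull G"
    using L l by (auto simp: image_iff add.assoc intro: subspace_add)
  then obtain m where m: "m > 1" "(1 - m) *\<^sub>R (x + l) + m *\<^sub>R x \<in> G"
    using convex_rel_interior_if2[OF face_of_imp_convex[OF G(1)] G(2)] by blast
  define s where "s = m - 1"
  have s: "0 < s"
    using m(1) by (simp add: s_def)
  have "(1 - m) *\<^sub>R (x + l) + m *\<^sub>R x = x - s *\<^sub>R l"
    by (simp add: s_def algebra_simps)
  then have "x - s *\<^sub>R l \<in> P"
    using m(2) face_of_imp_subset[OF G(1)] by auto
  then have "(1 / (1 + s)) *\<^sub>R (x - s *\<^sub>R l) + (s / (1 + s)) *\<^sub>R c \<in> interior P"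
    by (rule convex_interior_mix[OF assms(1) _ c s])
  moreover have "(1 / (1 + s)) *\<^sub>R (x - s *\<^sub>R l) + (s / (1 + s)) *\<^sub>R c = x + (s / (1 + s)) *\<^sub>R u"
  proof -
    have "c = x + l + u"
      using lu by (simp add: algebra_simps)
    then have "(1 / (1 + s)) *\<^sub>R (x - s *\<^sub>R l) + (s / (1 + s)) *\<^sub>R c
        = (1 / (1 + s)) *\<^sub>R ((1 + s) *\<^sub>R x) + (s / (1 + s)) *\<^sub>R u"
      by (simp add: algebra_simps)
    then show ?thesis
      using s by simp
  qed
  ultimately have "x + (s / (1 + s)) *\<^sub>R u \<in> interior P"
    by simp
  moreover have "x + (s / (1 + s)) *\<^sub>R u - p = (1 / 2) *\<^sub>R (q - p) + (s / (1 + s)) *\<^sub>R u"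
  proof -
    have "x - p = (1 / 2) *\<^sub>R (q - p)"
      using midpoint_eq_iff[of p q x] by (simp add: x_def midpoint_def algebra_simps flip: scaleR_2)
    then show ?thesis
      by (simp add: algebra_simps)
  qed
  then have "x + (s / (1 + s)) *\<^sub>R u - p \<in> K"
    using assms(3,8) u by (simp only:) (intro subspace_add subspace_scale)
  ultimately show ?thesis
    by blast
qed

text \<open>The image of a linear right inverse of \<open>A\<close> is a complement of the kernel.\<close>

lemma dim_kernel_surj:
  fixes A :: "'a::euclidean_space \<Rightarrow> 'b::euclidean_space"
  assumes "linear A" "surj A"
  shows "dim (lin_kernel A) + DIM('b) \<le> DIM('a)"
proof -
  interpret linear A by fact
  obtain g where g: "linear g" "A \<circ> g = id"
    using linear_surjective_right_inverse[OF assms] by blast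
  then have Ag: "A (g y) = y" for y
    by (metis comp_apply id_apply)
  then have "inj g"
    by (metis injI)
  then have "dim (range g) = DIM('b)"
    using dim_image_eq[OF g(1), of UNIV] by simp
  moreover have "range g \<inter> lin_kernel A \<subseteq> {0}"
    using Ag linear_0[OF g(1)] by fastforce
  then have "dim (range g \<inter> lin_kernel A) = 0"
    by (simp add: dim_eq_0)
  ultimately show ?thesis
    using dim_sums_Int[OF linear_subspace_image[OF g(1) subspace_UNIV]
        linear_subspace_kernel[OF assms(1)]]
      dim_subset_UNIV[of "{x + y |x y. x \<in> range g \<and> y \<in> lin_kernel A}"] by linarith
qed

text \<open>
  If the dimension of \<open>F\<close> is at most the codimension of the kernel, general position makes the direction
  space of \<open>F\<close> meet the kernel only in \<open>0\<close>.
\<close>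

lemma general_position_aff_dim_image:
  fixes A :: "'a::euclidean_space \<Rightarrow> 'b::euclidean_space"
  assumes "linear A" "surj A" "convex_general_position F (lin_kernel A)" "F \<noteq> {}"
    and "aff_dim F \<le> int DIM('b)"
  shows "aff_dim (A ` F) = aff_dim F"
proof -
  interpret linear A by fact
  obtain L t where L: "subspace L" "affine hull F = (+) t ` L"
    and d: "int (dim (L \<inter> lin_kernel A)) = max (int (dim L) - (int DIM('a) - int (dim (lin_kernel A)))) 0"
    using assms(3) unfolding convex_general_position_def by blast
  have dL: "aff_dim F = int (dim L)"
    using L aff_dim_affine_hull[of F] by (simp add: aff_dim_translation_eq aff_dim_subspace)
  have "dim (lin_kernel A) + DIM('b) \<le> DIM('a)"
    using dim_kernel_surj[OF assms(1,2)] .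
  then have "dim (L \<inter> lin_kernel A) = 0"
    using d dL assms(5) by linarith
  then have "inj_on A (span L)"
    unfolding linear_inj_on_iff_eq_0[OF assms(1) subspace_span] using L(1)
    by (auto simp: dim_eq_0 span_eq_iff[THEN iffD2])
  then have "dim (A ` L) = dim L"
    using dim_image_eq[OF assms(1)] by blast
  moreover have "affine hull (A ` F) = (+) (A t) ` (A ` L)"
    using affine_hull_linear_image[of A F] L(2) assms(1)
    by (simp add: linear_conv_bounded_linear image_image add)
  then have "aff_dim (A ` F) = int (dim (A ` L))"
    using aff_dim_affine_hull[of "A ` F"] linear_subspace_image[OF assms(1) L(1)]
    by (simp add: aff_dim_translation_eq aff_dim_subspace)
  ultimately show ?thesis
    using dL by simp
qed

section \<open>Images of faces under linear maps\<close>

text \<open>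
  If a point of \<open>A F\<close> lies between \<open>A p\<close> and \<open>A q\<close>, the corresponding point between \<open>p\<close> and \<open>q\<close> differs
  from a point of \<open>F\<close> by an element of the tangent cone that lies in the kernel.
\<close>

lemma face_of_linear_image_if_tangent_cone:
  fixes P :: "'a::euclidean_space set" and A :: "'a \<Rightarrow> 'b::euclidean_space"
  assumes "convex P" "linear A" "F face_of P" "tangent_cone F P \<inter> lin_kernel A = {0}"
  shows "(A ` F) face_of (A ` P)"
  unfolding face_of_def
proof (intro conjI ballI impI)
  interpret linear A by fact
  show "A ` F \<subseteq> A ` P"
    using face_of_imp_subset[OF assms(3)] by blast
  show "convex (A ` F)"
    using face_of_imp_convex[OF assms(3)] assms(2) by (simp add: convex_linear_image)
  fix a b x
  assume "a \<in> A ` P" "b \<in> A ` P" "x \<in> A ` F" and x: "x \<in> open_segment a b"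
  then obtain p q f where pqf: "p \<in> P" "q \<in> P" "f \<in> F" and abx: "a = A p" "b = A q" "x = A f"
    by blast
  obtain s where s: "0 < s" "s < 1" "x = (1 - s) *\<^sub>R a + s *\<^sub>R b" and "a \<noteq> b"
    using x by (auto simp: in_segment)
  let ?y = "(1 - s) *\<^sub>R p + s *\<^sub>R q"
  have "?y \<in> P"
    using s pqf assms(1) by (auto simp: convex_alt)
  then have "?y - f \<in> tangent_cone F P"
    using diff_mem_tangent_cone[OF assms(1,3) pqf(3)] by blast
  moreover have "A (?y - f) = 0"
    using s(3) by (simp add: add diff scale abx)
  ultimately have "?y - f \<in> {0}"
    using assms(4) by blast
  then have "?y \<in> F"
    using pqf(3) by simp
  moreover have "?y \<in> open_segment p q"
    using s \<open>a \<noteq> b\<close> abx by (auto simp: in_segment)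
  ultimately have "p \<in> F" "q \<in> F"
    using face_ofD[OF assms(3) _ pqf(1,2)] by blast+
  then show "a \<in> A ` F" "b \<in> A ` F"
    using abx by auto
qed

theorem proposition5p3:
  fixes P F :: "(real ^ 'd) set"
    and A :: "real ^ 'd \<Rightarrow> real ^ 'k"
    and j :: nat
  assumes "polyhedron P"
    and "interior P \<noteq> {}"
    and "j < CARD('k)"
    and "CARD('k) \<le> CARD('d)"
    and "linear A"
    and "dim (range A) = CARD('k)"
    and "general_position (lin_kernel A) P"
    and "F face_of P"
    and "aff_dim F = int j"
  shows "((A ` F) face_of (A ` P) \<longleftrightarrow>
            (A ` F) face_of (A ` P) \<and> aff_dim (A ` F) = int j) \<and>
         ((A ` F) face_of (A ` P) \<longleftrightarrow> A ` F \<inter> interior (A ` P) = {}) \<and>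
         ((A ` F) face_of (A ` P) \<longleftrightarrow> A ` tangent_cone F P \<noteq> UNIV) \<and>
         ((A ` F) face_of (A ` P) \<longleftrightarrow> interior (tangent_cone F P) \<inter> lin_kernel A = {}) \<and>
         ((A ` F) face_of (A ` P) \<longleftrightarrow> tangent_cone F P \<inter> lin_kernel A = {0})"
proof -
  interpret A: linear A by fact
  let ?T = "tangent_cone F P" and ?K = "lin_kernel A"
  have P: "convex P"
    using assms(1) by (rule polyhedron_imp_convex)
  have surj: "surj A"
    using assms(6) dim_eq_full[of "range A"] linear_subspace_image[OF assms(5) subspace_UNIV]
    by (simp add: span_eq_iff[THEN iffD2])
  have K: "subspace ?K"
    using assms(5) by (rule linear_subspace_kernel)
  have "F \<noteq> {}"
    using assms(9) by force
  then obtain f0 where f0: "f0 \<in> rel_interior F"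
    using face_of_imp_convex[OF assms(8)] rel_interior_eq_empty[of F] by blast
  then have f0F: "f0 \<in> F"
    using rel_interior_subset by blast
  then have f0P: "f0 \<in> P"
    using face_of_imp_subset[OF assms(8)] by blast

  have image_interior: "A ` interior P \<subseteq> interior (A ` P)"
    using open_surjective_linear_image[OF open_interior assms(5) surj]
    by (intro interior_maximal image_mono interior_subset)

  have dim: "aff_dim (A ` F) = int j"
  proof -
    have "convex_general_position F ?K"
      using assms(7,8) \<open>F \<noteq> {}\<close> unfolding general_position_def by blast
    then show ?thesis
      using general_position_aff_dim_image[OF assms(5) surj _ \<open>F \<noteq> {}\<close>] assms(3,9) by simp
  qed

  have ac: "A ` F \<inter> interior (A ` P) = {}" if "(A ` F) face_of (A ` P)"
  proof (rule face_of_disjoint_interior[OF that])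
    have "interior (A ` P) \<noteq> {}"
      using image_interior assms(2) by blast
    then have "aff_dim (A ` P) = int CARD('k)"
      using aff_dim_nonempty_interior by fastforce
    then show "A ` F \<noteq> A ` P"
      using dim assms(3) by auto
  qed

  have cd: "A ` ?T \<noteq> UNIV" if "A ` F \<inter> interior (A ` P) = {}"
  proof
    assume "A ` ?T = UNIV"
    then obtain w where "w \<in> interior P" "A w = A f0"
      using tangent_cone_image_UNIV_imp_interior[OF P assms(2,5,8) f0] by blast
    then have "A f0 \<in> A ` F \<inter> interior (A ` P)"
      using image_interior f0F by (metis IntI imageI subsetD)
    with that show False
      by blast
  qed

  have de: "interior ?T \<inter> ?K = {}" if "A ` ?T \<noteq> UNIV"
    using image_cone_eq_UNIV[OF assms(5) surj tangent_cone_scaleR[of _ F P]] that by blast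

  have ef: "?T \<inter> ?K = {0}" if e: "interior ?T \<inter> ?K = {}"
  proof
    have "0 \<in> ?T"
      using diff_mem_tangent_cone[OF P assms(8) f0F f0P] by simp
    then show "{0} \<subseteq> ?T \<inter> ?K"
      by (simp add: A.zero)
    show "?T \<inter> ?K \<subseteq> {0}"
    proof (rule subsetI, rule ccontr)
      fix v assume v: "v \<in> ?T \<inter> ?K" and "v \<notin> {0}"
      then obtain r where r: "0 < r" "f0 + r *\<^sub>R v \<in> P"
        using tangent_cone_eq[OF P assms(8) f0] by auto
      have "f0 + r *\<^sub>R v - f0 \<in> ?K" "f0 \<noteq> f0 + r *\<^sub>R v"
        using v \<open>v \<notin> {0}\<close> r(1) by (auto simp: A.scale)
      then obtain w where "w \<in> interior P" "w - f0 \<in> ?K"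
        using general_position_fibre_meets_interior[OF P assms(2) K assms(7) f0P r(2)] by blast
      then show False
        using interior_diff_mem_interior_tangent_cone[OF P assms(8) f0F] e by blast
    qed
  qed

  have fa: "(A ` F) face_of (A ` P)" if "?T \<inter> ?K = {0}"
    using P assms(5,8) that by (rule face_of_linear_image_if_tangent_cone)

  show ?thesis
    using dim ac cd de ef fa by blast
qed

end
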